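(* Let $G$ be a compact connected Lie group with Lie algebra $\mathfrak{g}$, endowed with a bi-invariant affine connection $\nabla$ whose Nomizu map $\Lambda:\mathfrak{g}\to\mathrm{End}(\mathfrak{g})$ satisfies $\Lambda(X)X=0$ for all $X\in\mathfrak{g}$. Then $\Lambda$ is a derivation of $\mathfrak{g}$, i.e. $\Lambda:\mathfrak{g}\to\mathrm{Der}(\mathfrak{g})$, if and only if the curvature $R$ and the covariant derivative of the torsion $T$ of $\nabla$ satisfy $$(\nabla_{Z}T)(X,Y)=2\big\{R(Z,X)Y-\Lambda(Y)\big([Z,X]-\Lambda(Z)X\big)\big\},\qquad\forall\ X,Y,Z\in\mathfrak{g}.$$
   Context: A bi-invariant affine connection on $G$ is a $(G\times G)$-invariant affine connection, where $G\cong(G\times G)/\Delta G$. It is determined by its Nomizu map, a linear map $\Lambda:\mathfrak{g}\to\mathrm{End}(\mathfrak{g})$ with $\Lambda(\mathrm{Ad}(g)X)=\mathrm{Ad}(g)\Lambda(X)\mathrm{Ad}(g)^{-1}$ for $g\in G$; one has $T(X,Y)=\Lambda(X)Y-\Lambda(Y)X-[X,Y]$, $R(X,Y)=[\Lambda(X),\Lambda(Y)]-\Lambda([X,Y])$, and $(\nabla_ZT)(X,Y)=\Lambda(Z)T(X,Y)-T(\Lambda(Z)X,Y)-T(X,\Lambda(Z)Y)$ for $X,Y,Z\in\mathfrak{g}$. "$\Lambda$ is a derivation" means $\Lambda(X)$ is a derivation of the Lie algebra $\mathfrak{g}$ for every $X\in\mathfrak{g}$. *)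

theory Defs
  imports "HOL-Analysis.Analysis" "HOL-Algebra.Group" "HOL-Library.Function_Algebras"
begin

text \<open>
  Lie groups, vector fields and affine connections. Sums, differences and products of functions
  (and of operators on functions) are the pointwise ones of \<^theory>\<open>HOL-Library.Function_Algebras\<close>.
\<close>

section \<open>Smooth functions on open subsets of Euclidean space\<close>

text \<open>
  Euclidean space of dimension \<open>n\<close> is the library's \<^const>\<open>Euclidean_space\<close> (sequences vanishing
  from index \<open>n\<close> on), so that the dimension is an arbitrary natural number, 0 included.
  A function is of class \<open>C^k\<close> on an open set if all its iterated partial derivatives of order at
  most \<open>k\<close> exist and are continuous there.
\<close>

definition partial_deriv :: "nat \<Rightarrow> ((nat \<Rightarrow> real) \<Rightarrow> real) \<Rightarrow> (nat \<Rightarrow> real) \<Rightarrow> real" where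
  "partial_deriv i f x = deriv (\<lambda>t. f (x(i := t))) (x i)"

primrec Ck_on :: "nat \<Rightarrow> nat \<Rightarrow> (nat \<Rightarrow> real) set \<Rightarrow> ((nat \<Rightarrow> real) \<Rightarrow> real) \<Rightarrow> bool" where
  "Ck_on 0 n S f \<longleftrightarrow> continuous_map (subtopology (Euclidean_space n) S) euclideanreal f"
| "Ck_on (Suc k) n S f \<longleftrightarrow>
     continuous_map (subtopology (Euclidean_space n) S) euclideanreal f \<and>
     (\<forall>i<n. (\<forall>x\<in>S. (\<lambda>t. f (x(i := t))) differentiable (at (x i))) \<and>
             Ck_on k n S (partial_deriv i f))"

definition smooth_on :: "nat \<Rightarrow> (nat \<Rightarrow> real) set \<Rightarrow> ((nat \<Rightarrow> real) \<Rightarrow> real) \<Rightarrow> bool" where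
  "smooth_on n S f \<longleftrightarrow> (\<forall>k. Ck_on k n S f)"


section \<open>Smooth manifolds\<close>

record 'p manifold =
  mtop :: "'p topology"
  mdim :: nat
  atlas :: "('p set \<times> ('p \<Rightarrow> nat \<Rightarrow> real)) set"

definition chart :: "'p topology \<Rightarrow> nat \<Rightarrow> 'p set \<Rightarrow> ('p \<Rightarrow> nat \<Rightarrow> real) \<Rightarrow> bool" where
  "chart X n U \<phi> \<longleftrightarrow>
     openin X U \<and> openin (Euclidean_space n) (\<phi> ` U) \<and>
     homeomorphic_map (subtopology X U) (subtopology (Euclidean_space n) (\<phi> ` U)) \<phi>"

locale smooth_manifold =
  fixes M :: "'p manifold"
  assumes hausdorff: "Hausdorff_space (mtop M)"
    and second_countable: "second_countable (mtop M)"
    and charts: "\<And>U \<phi>. (U, \<phi>) \<in> atlas M \<Longrightarrow> chart (mtop M) (mdim M) U \<phi>"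
    and cover: "topspace (mtop M) = (\<Union>(U, \<phi>)\<in>atlas M. U)"
    and compatible: "\<And>U \<phi> V \<psi> j. (U, \<phi>) \<in> atlas M \<Longrightarrow> (V, \<psi>) \<in> atlas M \<Longrightarrow> j < mdim M \<Longrightarrow>
      smooth_on (mdim M) (\<phi> ` (U \<inter> V)) (\<lambda>x. \<psi> (inv_into U \<phi> x) j)"

definition product_manifold :: "'p manifold \<Rightarrow> 'q manifold \<Rightarrow> ('p \<times> 'q) manifold" where
  "product_manifold M N =
     \<lparr> mtop = prod_topology (mtop M) (mtop N),
       mdim = mdim M + mdim N,
       atlas = {(U \<times> V, \<lambda>(p, q) i. if i < mdim M then \<phi> p i else \<psi> q (i - mdim M)) | U \<phi> V \<psi>.
                  (U, \<phi>) \<in> atlas M \<and> (V, \<psi>) \<in> atlas N} \<rparr>"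

definition smooth_map :: "'p manifold \<Rightarrow> 'q manifold \<Rightarrow> ('p \<Rightarrow> 'q) \<Rightarrow> bool" where
  "smooth_map M N F \<longleftrightarrow>
     continuous_map (mtop M) (mtop N) F \<and>
     (\<forall>(U, \<phi>)\<in>atlas M. \<forall>(V, \<psi>)\<in>atlas N. \<forall>j<mdim N.
        smooth_on (mdim M) (\<phi> ` {p\<in>U. F p \<in> V}) (\<lambda>x. \<psi> (F (inv_into U \<phi> x)) j))"

text \<open>
  The algebra of smooth real functions on \<open>M\<close>. Since HOL functions are total, a function on \<open>M\<close>
  is represented by its extension by 0 to the whole type.
\<close>

definition smooth_functions :: "'p manifold \<Rightarrow> ('p \<Rightarrow> real) set" where
  "smooth_functions M =
     {f. (\<forall>p. p \<notin> topspace (mtop M) \<longrightarrow> f p = 0) \<and>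
         (\<forall>(U, \<phi>)\<in>atlas M. smooth_on (mdim M) (\<phi> ` U) (\<lambda>x. f (inv_into U \<phi> x)))}"


section \<open>Vector fields\<close>

text \<open>
  A smooth vector field is a derivation of the algebra of smooth functions, extended by 0 to
  operators on all functions so that equality of vector fields is equality in HOL.
\<close>

type_synonym 'p vfield = "('p \<Rightarrow> real) \<Rightarrow> ('p \<Rightarrow> real)"

definition fscale :: "('p \<Rightarrow> real) \<Rightarrow> 'p vfield \<Rightarrow> 'p vfield" where
  "fscale h X = (\<lambda>f. h * X f)"

definition rscale :: "real \<Rightarrow> 'p vfield \<Rightarrow> 'p vfield" where
  "rscale c X = (\<lambda>f p. c * X f p)"

definition vector_fields :: "'p manifold \<Rightarrow> 'p vfield set" where
  "vector_fields M =
     {X. (\<forall>f. f \<notin> smooth_functions M \<longrightarrow> X f = 0) \<and>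
         (\<forall>f\<in>smooth_functions M. X f \<in> smooth_functions M) \<and>
         (\<forall>f\<in>smooth_functions M. \<forall>g\<in>smooth_functions M. X (f + g) = X f + X g) \<and>
         (\<forall>f\<in>smooth_functions M. \<forall>c::real. X (\<lambda>p. c * f p) = (\<lambda>p. c * X f p)) \<and>
         (\<forall>f\<in>smooth_functions M. \<forall>g\<in>smooth_functions M. X (f * g) = X f * g + f * X g)}"

definition bracket :: "'p vfield \<Rightarrow> 'p vfield \<Rightarrow> 'p vfield" where
  "bracket X Y = (\<lambda>f. X (Y f) - Y (X f))"

definition pullback :: "'p manifold \<Rightarrow> ('p \<Rightarrow> 'p) \<Rightarrow> ('p \<Rightarrow> real) \<Rightarrow> ('p \<Rightarrow> real)" where
  "pullback M F f = (\<lambda>p. if p \<in> topspace (mtop M) then f (F p) else 0)"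

text \<open>Push-forward of a vector field along a diffeomorphism \<open>F\<close> of \<open>M\<close> onto itself.\<close>

definition pushforward :: "'p manifold \<Rightarrow> ('p \<Rightarrow> 'p) \<Rightarrow> 'p vfield \<Rightarrow> 'p vfield" where
  "pushforward M F X =
     (\<lambda>f. if f \<in> smooth_functions M
          then pullback M (inv_into (topspace (mtop M)) F) (X (pullback M F f)) else 0)"


section \<open>Affine connections\<close>

definition affine_connection :: "'p manifold \<Rightarrow> ('p vfield \<Rightarrow> 'p vfield \<Rightarrow> 'p vfield) \<Rightarrow> bool" where
  "affine_connection M conn \<longleftrightarrow>
     (\<forall>X\<in>vector_fields M. \<forall>Y\<in>vector_fields M. conn X Y \<in> vector_fields M) \<and>
     (\<forall>X\<in>vector_fields M. \<forall>X'\<in>vector_fields M. \<forall>Y\<in>vector_fields M.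
        conn (X + X') Y = conn X Y + conn X' Y) \<and>
     (\<forall>h\<in>smooth_functions M. \<forall>X\<in>vector_fields M. \<forall>Y\<in>vector_fields M.
        conn (fscale h X) Y = fscale h (conn X Y)) \<and>
     (\<forall>X\<in>vector_fields M. \<forall>Y\<in>vector_fields M. \<forall>Y'\<in>vector_fields M.
        conn X (Y + Y') = conn X Y + conn X Y') \<and>
     (\<forall>c. \<forall>X\<in>vector_fields M. \<forall>Y\<in>vector_fields M.
        conn X (rscale c Y) = rscale c (conn X Y)) \<and>
     (\<forall>h\<in>smooth_functions M. \<forall>X\<in>vector_fields M. \<forall>Y\<in>vector_fields M.
        conn X (fscale h Y) = fscale (X h) Y + fscale h (conn X Y))"

definition torsion :: "('p vfield \<Rightarrow> 'p vfield \<Rightarrow> 'p vfield) \<Rightarrow> 'p vfield \<Rightarrow> 'p vfield \<Rightarrow> 'p vfield" where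
  "torsion conn X Y = conn X Y - conn Y X - bracket X Y"

definition curvature ::
  "('p vfield \<Rightarrow> 'p vfield \<Rightarrow> 'p vfield) \<Rightarrow> 'p vfield \<Rightarrow> 'p vfield \<Rightarrow> 'p vfield \<Rightarrow> 'p vfield" where
  "curvature conn X Y Z = conn X (conn Y Z) - conn Y (conn X Z) - conn (bracket X Y) Z"

text \<open>\<open>cov_torsion conn Z X Y\<close> is the vector field \<open>(\<nabla>\<^sub>Z T)(X, Y)\<close>.\<close>

definition cov_torsion ::
  "('p vfield \<Rightarrow> 'p vfield \<Rightarrow> 'p vfield) \<Rightarrow> 'p vfield \<Rightarrow> 'p vfield \<Rightarrow> 'p vfield \<Rightarrow> 'p vfield" where
  "cov_torsion conn Z X Y =
     conn Z (torsion conn X Y) - torsion conn (conn Z X) Y - torsion conn X (conn Z Y)"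


section \<open>Lie groups and bi-invariant connections\<close>

locale lie_group = group G + smooth_manifold M
  for G :: "('p, 'b) monoid_scheme" (structure) and M :: "'p manifold" +
  assumes carrier_eq: "topspace (mtop M) = carrier G"
    and smooth_mult: "smooth_map (product_manifold M M) M (\<lambda>(x, y). x \<otimes> y)"
    and smooth_inv: "smooth_map M M (\<lambda>x. inv x)"

text \<open>The Lie algebra, as the space of left-invariant vector fields.\<close>

definition lie_algebra :: "('p, 'b) monoid_scheme \<Rightarrow> 'p manifold \<Rightarrow> 'p vfield set" where
  "lie_algebra G M =
     {X \<in> vector_fields M. \<forall>a\<in>carrier G. pushforward M (\<lambda>x. a \<otimes>\<^bsub>G\<^esub> x) X = X}"

text \<open>
  \<open>G \<times> G\<close> acts on \<open>G \<cong> (G \<times> G) / \<Delta>G\<close> by \<open>(a, b) \<cdot> x = a x b\<inverse>\<close>.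
\<close>

definition biaction :: "('p, 'b) monoid_scheme \<Rightarrow> 'p \<Rightarrow> 'p \<Rightarrow> 'p \<Rightarrow> 'p" where
  "biaction G a b x = a \<otimes>\<^bsub>G\<^esub> x \<otimes>\<^bsub>G\<^esub> inv\<^bsub>G\<^esub> b"

definition bi_invariant_connection ::
  "('p, 'b) monoid_scheme \<Rightarrow> 'p manifold \<Rightarrow> ('p vfield \<Rightarrow> 'p vfield \<Rightarrow> 'p vfield) \<Rightarrow> bool" where
  "bi_invariant_connection G M conn \<longleftrightarrow>
     affine_connection M conn \<and>
     (\<forall>a\<in>carrier G. \<forall>b\<in>carrier G. \<forall>X\<in>vector_fields M. \<forall>Y\<in>vector_fields M.
        pushforward M (biaction G a b) (conn X Y) =
        conn (pushforward M (biaction G a b) X) (pushforward M (biaction G a b) Y))"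

text \<open>
  The Nomizu map relative to the reductive complement \<open>\<gg> \<times> 0\<close> of \<open>\<Delta>\<gg>\<close> in \<open>\<gg> \<times> \<gg>\<close>: it sends
  \<open>X\<close> to the endomorphism \<open>Y \<mapsto> \<nabla>\<^sub>X Y\<close> of the space of left-invariant fields. With this choice the
  torsion and curvature above restrict to \<open>\<Lambda>(X)Y - \<Lambda>(Y)X - [X,Y]\<close> and
  \<open>[\<Lambda>(X),\<Lambda>(Y)] - \<Lambda>([X,Y])\<close> on the Lie algebra.
\<close>

definition nomizu ::
  "('p, 'b) monoid_scheme \<Rightarrow> 'p manifold \<Rightarrow> ('p vfield \<Rightarrow> 'p vfield \<Rightarrow> 'p vfield) \<Rightarrow>
   'p vfield \<Rightarrow> 'p vfield \<Rightarrow> 'p vfield" where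
  "nomizu G M conn = (\<lambda>X\<in>lie_algebra G M. \<lambda>Y\<in>lie_algebra G M. conn X Y)"

definition lie_derivation ::
  "('p, 'b) monoid_scheme \<Rightarrow> 'p manifold \<Rightarrow> ('p vfield \<Rightarrow> 'p vfield) \<Rightarrow> bool" where
  "lie_derivation G M D \<longleftrightarrow>
     (\<forall>X\<in>lie_algebra G M. D X \<in> lie_algebra G M) \<and>
     (\<forall>X\<in>lie_algebra G M. \<forall>Y\<in>lie_algebra G M. D (X + Y) = D X + D Y) \<and>
     (\<forall>c. \<forall>X\<in>lie_algebra G M. D (rscale c X) = rscale c (D X)) \<and>
     (\<forall>X\<in>lie_algebra G M. \<forall>Y\<in>lie_algebra G M.
        D (bracket X Y) = bracket (D X) Y + bracket X (D Y))"

end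

theory Submission
  imports Defs
begin

text \<open>
  On left-invariant fields the statement is an identity of linear algebra. Polarising
  \<open>\<Lambda>(X)X = 0\<close> makes \<open>\<Lambda>\<close> skew, \<open>\<Lambda>(X)Y = - \<Lambda>(Y)X\<close>, so that \<open>T(X,Y) = 2\<Lambda>(X)Y - [X,Y]\<close>. Expanding
  both sides of the displayed equation, the terms \<open>2\<Lambda>(Z)\<Lambda>(X)Y\<close> and \<open>-2\<Lambda>(X)\<Lambda>(Z)Y\<close> occur on both
  sides; \<open>-2\<Lambda>(\<Lambda>(Z)X)Y\<close> on the left equals \<open>2\<Lambda>(Y)\<Lambda>(Z)X\<close> on the right; and in the right-hand side
  \<open>-2\<Lambda>([Z,X])Y\<close> from the curvature cancels \<open>-2\<Lambda>(Y)[Z,X]\<close>. What remains of the difference is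
  \<open>[\<Lambda>(Z)X,Y] + [X,\<Lambda>(Z)Y] - \<Lambda>(Z)[X,Y]\<close>,
  the defect of \<open>\<Lambda>(Z)\<close> from being a derivation: this is \<open>cov_torsion_defect\<close>.

  The cancellation takes place inside the space of left-invariant fields, so this has to be a
  linear subspace of the vector fields that is closed under the bracket and under \<open>\<nabla>\<close>. Closure under
  \<open>\<nabla>\<close> is left-invariance of the connection. For the bracket, left-invariance is rephrased as
  commutation with the pullbacks \<open>f \<mapsto> f \<circ> L\<^sub>a\<close> on smooth functions, a condition that commutators
  inherit. That the commutator of two derivations takes smooth values and is again a derivation
  rests on smooth functions being closed under sums and products.
\<close>

section \<open>The algebra of smooth functions\<close>

text \<open>
  Open sets of \<open>\<real>\<^sup>n\<close> are open along each coordinate line. This makes \<^const>\<open>partial_deriv\<close> at a point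
  of \<open>S\<close> depend only on the values on \<open>S\<close>, although functions are defined on all sequences.
\<close>

lemma eventually_fun_upd_in_open:
  assumes "openin (Euclidean_space n) S" "x \<in> S" "i < n"
  shows "\<forall>\<^sub>F t in nhds (x i). x(i := t) \<in> S"
proof -
  have xE: "x \<in> topspace (Euclidean_space n)"
    using assms openin_subset by blast
  have "continuous_map euclideanreal (Euclidean_space n) (\<lambda>t. x(i := t))"
    using xE assms(3)
    by (auto simp: Euclidean_space_def continuous_map_in_subtopology
        continuous_map_componentwise_UNIV topspace_Euclidean_space)
  then have "open {t. x(i := t) \<in> S}"
    using openin_continuous_map_preimage[OF _ assms(1)] by fastforce
  then show ?thesis
    using assms(2) by (auto simp: eventually_nhds)
qed

lemma partial_deriv_cong:
  assumes "openin (Euclidean_space n) S" "i < n" "\<And>x. x \<in> S \<Longrightarrow> f x = g x" "x \<in> S"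
  shows "partial_deriv i f x = partial_deriv i g x"
  unfolding partial_deriv_def
  by (rule deriv_cong_ev[OF eventually_mono[OF eventually_fun_upd_in_open[OF assms(1,4,2)]]])
    (auto intro: assms(3))

lemma Ck_on_cong:
  assumes S: "openin (Euclidean_space n) S" and "\<And>x. x \<in> S \<Longrightarrow> f x = g x" and "Ck_on k n S f"
  shows "Ck_on k n S g"
  using assms(2,3)
proof (induction k arbitrary: f g)
  case 0
  then show ?case
    by (auto intro: continuous_map_eq)
next
  case (Suc k)
  have "(\<lambda>t. g (x(i := t))) differentiable (at (x i))" if ix: "i < n" "x \<in> S" for i x
  proof -
    obtain D where D: "((\<lambda>t. f (x(i := t))) has_field_derivative D) (at (x i))"
      using Suc.prems(2) ix by (force simp: real_differentiable_def)
    have *: "\<forall>\<^sub>F t in nhds (x i). f (x(i := t)) = g (x(i := t))"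
      by (rule eventually_mono[OF eventually_fun_upd_in_open[OF S ix(2,1)]]) (rule Suc.prems(1))
    have "((\<lambda>t. g (x(i := t))) has_field_derivative D) (at (x i))"
      using DERIV_cong_ev[OF refl * refl] D by simp
    then show ?thesis
      by (auto simp: real_differentiable_def)
  qed
  moreover have "Ck_on k n S (partial_deriv i g)" if "i < n" for i
  proof (rule Suc.IH)
    show "Ck_on k n S (partial_deriv i f)"
      using Suc.prems(2) that by simp
  qed (rule partial_deriv_cong[OF S that Suc.prems(1)])
  moreover have "continuous_map (subtopology (Euclidean_space n) S) euclideanreal g"
    using Suc.prems(2) by (intro continuous_map_eq[where f = f and g = g]) (auto simp: Suc.prems(1))
  ultimately show ?case
    by simp
qed

lemma Ck_on_Suc_imp: "Ck_on (Suc k) n S f \<Longrightarrow> Ck_on k n S f"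
  by (induction k arbitrary: f) auto

lemma Ck_on_const: "Ck_on k n S (\<lambda>_. c)"
proof (induction k arbitrary: c)
  case (Suc k)
  have "partial_deriv i (\<lambda>_. c) = (\<lambda>_. 0)" for i
    by (simp add: partial_deriv_def fun_eq_iff)
  with Suc show ?case
    by simp
qed simp

lemma Ck_on_add:
  assumes S: "openin (Euclidean_space n) S" and "Ck_on k n S f" "Ck_on k n S g"
  shows "Ck_on k n S (\<lambda>x. f x + g x)"
  using assms(2,3)
proof (induction k arbitrary: f g)
  case 0
  then show ?case
    by (simp add: continuous_map_add)
next
  case (Suc k)
  have "Ck_on k n S (partial_deriv i (\<lambda>x. f x + g x))" if i: "i < n" for i
  proof (rule Ck_on_cong[OF S])
    show "Ck_on k n S (\<lambda>x. partial_deriv i f x + partial_deriv i g x)"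
      using Suc i by simp
    fix x assume "x \<in> S"
    then show "partial_deriv i f x + partial_deriv i g x = partial_deriv i (\<lambda>x. f x + g x) x"
      using Suc.prems i unfolding partial_deriv_def
      by (intro DERIV_imp_deriv[symmetric] DERIV_add)
        (auto simp: DERIV_deriv_iff_real_differentiable)
  qed
  with Suc.prems show ?case
    by (simp add: continuous_map_add differentiable_add)
qed

text \<open>
  The product rule expresses the partial derivatives of \<open>f g\<close> on \<open>S\<close> through products of functions
  of class \<open>C\<^sup>k\<close> when \<open>f\<close> and \<open>g\<close> are of class \<open>C\<^sup>k\<^sup>+\<^sup>1\<close>, which is what the induction on \<open>k\<close> needs.
\<close>

lemma Ck_on_mult:
  assumes S: "openin (Euclidean_space n) S" and "Ck_on k n S f" "Ck_on k n S g"
  shows "Ck_on k n S (\<lambda>x. f x * g x)"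
  using assms(2,3)
proof (induction k arbitrary: f g)
  case 0
  then show ?case
    by (simp add: continuous_map_real_mult)
next
  case (Suc k)
  have "Ck_on k n S (partial_deriv i (\<lambda>x. f x * g x))" if i: "i < n" for i
  proof (rule Ck_on_cong[OF S])
    show "Ck_on k n S (\<lambda>x. f x * partial_deriv i g x + partial_deriv i f x * g x)"
      using Suc.prems i Ck_on_Suc_imp[OF Suc.prems(1)] Ck_on_Suc_imp[OF Suc.prems(2)]
      by (intro Ck_on_add[OF S] Suc.IH) simp_all
    fix x assume "x \<in> S"
    then have "((\<lambda>t. f (x(i := t))) has_field_derivative partial_deriv i f x) (at (x i))"
      "((\<lambda>t. g (x(i := t))) has_field_derivative partial_deriv i g x) (at (x i))"
      using Suc.prems i by (auto simp: partial_deriv_def DERIV_deriv_iff_real_differentiable)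
    from DERIV_mult'[OF this]
    show "f x * partial_deriv i g x + partial_deriv i f x * g x = partial_deriv i (\<lambda>x. f x * g x) x"
      by (simp add: partial_deriv_def[of i "\<lambda>x. f x * g x"] DERIV_imp_deriv)
  qed
  with Suc.prems show ?case
    by (simp add: continuous_map_real_mult differentiable_mult)
qed

context smooth_manifold
begin

lemma chart_image_open: "(U, \<phi>) \<in> atlas M \<Longrightarrow> openin (Euclidean_space (mdim M)) (\<phi> ` U)"
  using charts by (auto simp: chart_def)

lemma smooth_functions_add:
  "f \<in> smooth_functions M \<Longrightarrow> g \<in> smooth_functions M \<Longrightarrow> f + g \<in> smooth_functions M"
  using chart_image_open
  by (auto simp: smooth_functions_def smooth_on_def intro!: Ck_on_add)

lemma smooth_functions_mult:
  "f \<in> smooth_functions M \<Longrightarrow> g \<in> smooth_functions M \<Longrightarrow> f * g \<in> smooth_functions M"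
  using chart_image_open
  by (auto simp: smooth_functions_def smooth_on_def intro!: Ck_on_mult)

lemma smooth_functions_scale:
  "f \<in> smooth_functions M \<Longrightarrow> (\<lambda>p. c * f p) \<in> smooth_functions M"
  using chart_image_open
  by (auto simp: smooth_functions_def smooth_on_def intro!: Ck_on_mult Ck_on_const)

lemma smooth_functions_diff:
  assumes "f \<in> smooth_functions M" "g \<in> smooth_functions M"
  shows "f - g \<in> smooth_functions M"
proof -
  have "f - g = f + (\<lambda>p. (-1) * g p)"
    by (auto simp: fun_eq_iff)
  then show ?thesis
    using assms smooth_functions_add smooth_functions_scale by presburger
qed

end


section \<open>The Lie algebra of vector fields\<close>

lemma smooth_function_outside:
  "f \<in> smooth_functions M \<Longrightarrow> p \<notin> topspace (mtop M) \<Longrightarrow> f p = 0"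
  by (auto simp: smooth_functions_def)

context
  fixes X :: "'p vfield" and M :: "'p manifold"
  assumes X: "X \<in> vector_fields M"
begin

lemma vfield_nonsmooth: "f \<notin> smooth_functions M \<Longrightarrow> X f = 0"
  using X by (simp add: vector_fields_def)

lemma vfield_smooth: "f \<in> smooth_functions M \<Longrightarrow> X f \<in> smooth_functions M"
  using X by (simp add: vector_fields_def)

lemma vfield_add:
  "f \<in> smooth_functions M \<Longrightarrow> g \<in> smooth_functions M \<Longrightarrow> X (f + g) = X f + X g"
  using X by (simp add: vector_fields_def)

lemma vfield_scale: "f \<in> smooth_functions M \<Longrightarrow> X (\<lambda>p. c * f p) = (\<lambda>p. c * X f p)"
  using X by (simp add: vector_fields_def)

lemma vfield_mult:
  "f \<in> smooth_functions M \<Longrightarrow> g \<in> smooth_functions M \<Longrightarrow> X (f * g) = X f * g + f * X g"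
  using X by (simp add: vector_fields_def)

lemma vfield_zero: "X 0 = 0"
proof (cases "0 \<in> smooth_functions M")
  case True
  then show ?thesis
    using vfield_scale[OF True, of 0] by (simp add: zero_fun_def)
qed (rule vfield_nonsmooth)

lemma vfield_outside: "p \<notin> topspace (mtop M) \<Longrightarrow> X f p = 0"
  by (cases "f \<in> smooth_functions M")
    (simp_all add: smooth_function_outside[OF vfield_smooth] vfield_nonsmooth)

end

context smooth_manifold
begin

lemma vector_fields_add:
  assumes "X \<in> vector_fields M" "Y \<in> vector_fields M"
  shows "X + Y \<in> vector_fields M"
  using assms smooth_functions_add
  by (auto simp: vector_fields_def algebra_simps fun_eq_iff)

lemma vector_fields_rscale:
  assumes "X \<in> vector_fields M"
  shows "rscale c X \<in> vector_fields M"
  using assms smooth_functions_scale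
  by (auto simp: vector_fields_def rscale_def algebra_simps fun_eq_iff)

text \<open>
  In \<open>X(Y(fg)) - Y(X(fg))\<close> the mixed terms \<open>Xf Yg\<close> and \<open>Yf Xg\<close> are symmetric in \<open>X\<close> and \<open>Y\<close> and cancel.
\<close>

lemma vector_fields_bracket:
  assumes X: "X \<in> vector_fields M" and Y: "Y \<in> vector_fields M"
  shows "bracket X Y \<in> vector_fields M"
proof -
  note XY = vfield_smooth[OF X] vfield_smooth[OF Y]
  have "bracket X Y f = 0" if "f \<notin> smooth_functions M" for f
    using that by (simp add: bracket_def vfield_nonsmooth[OF X] vfield_nonsmooth[OF Y]
        vfield_zero[OF X] vfield_zero[OF Y])
  moreover have "bracket X Y f \<in> smooth_functions M" if "f \<in> smooth_functions M" for f
    using that by (simp add: bracket_def XY smooth_functions_diff)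
  moreover have "bracket X Y (f + g) = bracket X Y f + bracket X Y g"
    if "f \<in> smooth_functions M" "g \<in> smooth_functions M" for f g
    using that by (simp add: bracket_def XY vfield_add[OF X] vfield_add[OF Y])
  moreover have "bracket X Y (\<lambda>p. c * f p) = (\<lambda>p. c * bracket X Y f p)"
    if "f \<in> smooth_functions M" for f c
    using that by (simp add: bracket_def XY vfield_scale[OF X] vfield_scale[OF Y]
        fun_eq_iff right_diff_distrib)
  moreover have "bracket X Y (f * g) = bracket X Y f * g + f * bracket X Y g"
    if "f \<in> smooth_functions M" "g \<in> smooth_functions M" for f g
    using that by (simp add: bracket_def XY smooth_functions_mult vfield_mult[OF X] vfield_mult[OF Y]
        vfield_add[OF X] vfield_add[OF Y] algebra_simps)
  ultimately show ?thesis
    by (simp add: vector_fields_def)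
qed

end


section \<open>Left-invariant vector fields\<close>

text \<open>
  Transporting \<open>X (f \<circ> F) \<circ> F\<inverse> = X f\<close> back along \<open>F\<close> turns invariance into commutation of two operators
  on functions. The equivalence also covers those \<open>f\<close> for which \<open>f \<circ> F\<close> is not smooth: \<open>X\<close> is 0 on
  \<open>f \<circ> F\<close> by convention, and either side then amounts to \<open>X f = 0\<close>.
\<close>

lemma pushforward_fixed_iff:
  assumes F: "bij_betw F (topspace (mtop M)) (topspace (mtop M))"
    and X: "X \<in> vector_fields M"
  shows "pushforward M F X = X \<longleftrightarrow>
    (\<forall>f\<in>smooth_functions M. X (pullback M F f) = pullback M F (X f))"
proof -
  let ?S = "topspace (mtop M)" and ?F' = "inv_into (topspace (mtop M)) F"
  have F'F: "?F' (F p) = p" "F p \<in> ?S" and FF': "F (?F' p) = p" "?F' p \<in> ?S" if "p \<in> ?S" for p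
    using that F by (auto simp: bij_betw_def inv_into_into f_inv_into_f)
  \<comment> \<open>On functions vanishing off the manifold the two pullbacks are mutually inverse.\<close>
  have *: "pullback M ?F' g = h \<longleftrightarrow> g = pullback M F h"
    if "\<And>p. p \<notin> ?S \<Longrightarrow> g p = 0" "\<And>p. p \<notin> ?S \<Longrightarrow> h p = 0" for g h
    using that F'F FF' by (fastforce simp: pullback_def fun_eq_iff)
  have "pushforward M F X = X \<longleftrightarrow>
    (\<forall>f\<in>smooth_functions M. pullback M ?F' (X (pullback M F f)) = X f)"
    using vfield_nonsmooth[OF X] by (auto simp: pushforward_def fun_eq_iff)
  then show ?thesis
    by (simp add: * vfield_outside[OF X])
qed

text \<open>
  This identifies the action of \<open>(a, \<one>)\<close> with left translation by \<open>a\<close>: the two agree on the group, but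
  not necessarily as total functions.
\<close>

lemma pushforward_cong:
  assumes "\<And>p. p \<in> topspace (mtop M) \<Longrightarrow> F p = F' p"
  shows "pushforward M F X = pushforward M F' X"
proof -
  have "pullback M F f = pullback M F' f" for f
    using assms by (auto simp: pullback_def)
  moreover have "inv_into (topspace (mtop M)) F = inv_into (topspace (mtop M)) F'"
    using assms by (auto simp: inv_into_def fun_eq_iff intro!: arg_cong[where f = Eps])
  ultimately show ?thesis
    by (intro ext) (simp add: pushforward_def)
qed

context lie_group
begin

lemma mem_lie_algebra_iff:
  "X \<in> lie_algebra G M \<longleftrightarrow> X \<in> vector_fields M \<and>
     (\<forall>a\<in>carrier G. \<forall>f\<in>smooth_functions M.
        X (pullback M (\<lambda>x. a \<otimes> x) f) = pullback M (\<lambda>x. a \<otimes> x) (X f))"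
proof -
  have "bij_betw (\<lambda>x. a \<otimes> x) (topspace (mtop M)) (topspace (mtop M))" if "a \<in> carrier G" for a
    using that inj_on_cmult surj_const_mult[OF that]
    by (simp add: bij_betw_def carrier_eq)
  then show ?thesis
    by (auto simp: lie_algebra_def pushforward_fixed_iff)
qed

lemma lie_algebra_vector_field: "X \<in> lie_algebra G M \<Longrightarrow> X \<in> vector_fields M"
  by (simp add: lie_algebra_def)

lemma lie_algebra_add:
  "X \<in> lie_algebra G M \<Longrightarrow> Y \<in> lie_algebra G M \<Longrightarrow> X + Y \<in> lie_algebra G M"
  by (auto simp: mem_lie_algebra_iff vector_fields_add pullback_def fun_eq_iff)

lemma lie_algebra_rscale: "X \<in> lie_algebra G M \<Longrightarrow> rscale c X \<in> lie_algebra G M"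
  using vector_fields_rscale[of X c]
  by (auto simp: mem_lie_algebra_iff rscale_def pullback_def fun_eq_iff)

lemma lie_algebra_minus: "X \<in> lie_algebra G M \<Longrightarrow> - X \<in> lie_algebra G M"
  using lie_algebra_rscale[of X "-1"] by (simp add: rscale_def fun_Compl_def)

text \<open>
  If \<open>X\<close> and \<open>Y\<close> commute with a pullback, then so do \<open>X Y\<close> and \<open>Y X\<close>; the commutation is only available
  on smooth functions, but \<open>X f\<close> and \<open>Y f\<close> are again smooth.
\<close>

lemma lie_algebra_bracket:
  assumes X: "X \<in> lie_algebra G M" and Y: "Y \<in> lie_algebra G M"
  shows "bracket X Y \<in> lie_algebra G M"
proof -
  have smooth: "X f \<in> smooth_functions M" "Y f \<in> smooth_functions M"
    if "f \<in> smooth_functions M" for f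
    using X Y that by (auto simp: lie_algebra_vector_field vfield_smooth)
  have "bracket X Y (pullback M (\<lambda>x. a \<otimes> x) f) = pullback M (\<lambda>x. a \<otimes> x) (bracket X Y f)"
    if a: "a \<in> carrier G" and f: "f \<in> smooth_functions M" for a f
  proof -
    let ?L = "pullback M (\<lambda>x. a \<otimes> x)"
    have "X (?L g) = ?L (X g)" "Y (?L g) = ?L (Y g)" if "g \<in> smooth_functions M" for g
      using X Y a that by (auto simp: mem_lie_algebra_iff)
    then have "bracket X Y (?L f) = ?L (X (Y f)) - ?L (Y (X f))"
      using f smooth by (simp add: bracket_def)
    also have "\<dots> = ?L (bracket X Y f)"
      by (auto simp: bracket_def pullback_def fun_eq_iff)
    finally show ?thesis .
  qed
  then show ?thesis
    using X Y by (auto simp: mem_lie_algebra_iff vector_fields_bracket)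
qed

lemma lie_algebra_conn:
  assumes conn: "bi_invariant_connection G M conn"
    and X: "X \<in> lie_algebra G M" and Y: "Y \<in> lie_algebra G M"
  shows "conn X Y \<in> lie_algebra G M"
proof -
  have "pushforward M (\<lambda>x. a \<otimes> x) (conn X Y) = conn X Y" if a: "a \<in> carrier G" for a
  proof -
    have left: "pushforward M (biaction G a \<one>) V = pushforward M (\<lambda>x. a \<otimes> x) V" for V
      using a by (intro pushforward_cong) (simp add: biaction_def carrier_eq)
    have "pushforward M (biaction G a \<one>) (conn X Y) =
        conn (pushforward M (biaction G a \<one>) X) (pushforward M (biaction G a \<one>) Y)"
      using conn X Y a by (simp add: bi_invariant_connection_def lie_algebra_vector_field)
    then show ?thesis
      using X Y a by (simp add: left lie_algebra_def)
  qed
  moreover have "conn X Y \<in> vector_fields M"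
    using conn X Y
    by (simp add: bi_invariant_connection_def affine_connection_def lie_algebra_vector_field)
  ultimately show ?thesis
    by (simp add: lie_algebra_def)
qed

end


section \<open>The defect of a skew product from being a derivation\<close>

lemma alternating_imp_skew:
  fixes \<Lambda> :: "'v::ab_group_add \<Rightarrow> 'v \<Rightarrow> 'v"
  assumes add: "\<And>x y. x \<in> L \<Longrightarrow> y \<in> L \<Longrightarrow> x + y \<in> L"
    and left: "\<And>x y z. x \<in> L \<Longrightarrow> y \<in> L \<Longrightarrow> z \<in> L \<Longrightarrow> \<Lambda> (x + y) z = \<Lambda> x z + \<Lambda> y z"
    and right: "\<And>x y z. x \<in> L \<Longrightarrow> y \<in> L \<Longrightarrow> z \<in> L \<Longrightarrow> \<Lambda> x (y + z) = \<Lambda> x y + \<Lambda> x z"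
    and alt: "\<And>x. x \<in> L \<Longrightarrow> \<Lambda> x x = 0"
    and "x \<in> L" "y \<in> L"
  shows "\<Lambda> y x = - \<Lambda> x y"
proof -
  have "0 = \<Lambda> (x + y) (x + y)"
    using add alt assms(5,6) by simp
  also have "\<dots> = \<Lambda> x x + \<Lambda> x y + (\<Lambda> y x + \<Lambda> y y)"
    using assms(5,6) by (simp add: add left right)
  also have "\<dots> = \<Lambda> x y + \<Lambda> y x"
    using assms(5,6) by (simp add: alt)
  finally show ?thesis
    by (simp add: eq_neg_iff_add_eq_0 add.commute)
qed

text \<open>
  Skewness turns \<open>\<nabla>\<close> of \<open>Y\<close> along \<open>\<nabla>\<^sub>Z X\<close> or along \<open>[Z,X]\<close> into \<open>- \<nabla>\<^sub>Y (\<nabla>\<^sub>Z X)\<close> or \<open>- \<nabla>\<^sub>Y [Z,X]\<close>; the terms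
  quadratic in \<open>\<nabla>\<close> then agree on both sides, and those in \<open>[Z,X]\<close> cancel within the right-hand side.
\<close>

lemma cov_torsion_defect:
  fixes conn :: "'p vfield \<Rightarrow> 'p vfield \<Rightarrow> 'p vfield"
  assumes add: "\<And>X Y. X \<in> L \<Longrightarrow> Y \<in> L \<Longrightarrow> X + Y \<in> L"
    and minus: "\<And>X. X \<in> L \<Longrightarrow> - X \<in> L"
    and br: "\<And>X Y. X \<in> L \<Longrightarrow> Y \<in> L \<Longrightarrow> bracket X Y \<in> L"
    and closed: "\<And>X Y. X \<in> L \<Longrightarrow> Y \<in> L \<Longrightarrow> conn X Y \<in> L"
    and left: "\<And>X Y Z. X \<in> L \<Longrightarrow> Y \<in> L \<Longrightarrow> Z \<in> L \<Longrightarrow> conn (X + Y) Z = conn X Z + conn Y Z"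
    and right: "\<And>X Y Z. X \<in> L \<Longrightarrow> Y \<in> L \<Longrightarrow> Z \<in> L \<Longrightarrow> conn X (Y + Z) = conn X Y + conn X Z"
    and alt: "\<And>X. X \<in> L \<Longrightarrow> conn X X = 0"
    and X: "X \<in> L" and Y: "Y \<in> L" and Z: "Z \<in> L"
  shows "cov_torsion conn Z X Y
      - rscale 2 (curvature conn Z X Y - conn Y (bracket Z X - conn Z X)) =
    bracket (conn Z X) Y + bracket X (conn Z Y) - conn Z (bracket X Y)"
proof -
  have skew: "conn V U = - conn U V" if "U \<in> L" "V \<in> L" for U V
    by (rule alternating_imp_skew[where L = L and \<Lambda> = conn])
      (fact add left right alt that)+
  have neg: "conn U (- V) = - conn U V" if "U \<in> L" "V \<in> L" for U V
  proof -
    have "0 \<in> L"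
      using add[OF that(2) minus[OF that(2)]] by simp
    then have "conn U 0 = 0"
      using right[OF that(1), of 0 0] by simp
    then have "conn U V + conn U (- V) = 0"
      using right[OF that minus[OF that(2)]] by simp
    then show ?thesis
      by (simp add: eq_neg_iff_add_eq_0 add.commute)
  qed
  have diff: "conn U (V - W) = conn U V - conn U W" if "U \<in> L" "V \<in> L" "W \<in> L" for U V W
    using right[OF that(1,2) minus[OF that(3)]] neg[OF that(1,3)] by simp
  have tor: "torsion conn U V = conn U V + conn U V - bracket U V" if "U \<in> L" "V \<in> L" for U V
    using skew[OF that] by (simp add: torsion_def)
  have two: "rscale 2 V = V + V" for V :: "'p vfield"
    by (simp add: rscale_def fun_eq_iff)
  have skews: "conn (conn Z X) Y = - conn Y (conn Z X)" "conn (bracket Z X) Y = - conn Y (bracket Z X)"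
    by (rule skew, rule Y, simp add: X Z closed br)+
  have conn_tor: "conn Z (torsion conn X Y) =
      conn Z (conn X Y) + conn Z (conn X Y) - conn Z (bracket X Y)"
    by (simp only: X Y Z closed br add tor diff right)
  have conn_diff: "conn Y (bracket Z X - conn Z X) = conn Y (bracket Z X) - conn Y (conn Z X)"
    by (simp add: X Y Z closed br diff)
  have "cov_torsion conn Z X Y = conn Z (conn X Y) + conn Z (conn X Y) - conn Z (bracket X Y)
      - (- conn Y (conn Z X) + - conn Y (conn Z X) - bracket (conn Z X) Y)
      - (conn X (conn Z Y) + conn X (conn Z Y) - bracket X (conn Z Y))"
    unfolding cov_torsion_def conn_tor by (simp only: X Y Z closed tor skews)
  moreover have "curvature conn Z X Y - conn Y (bracket Z X - conn Z X) =
      conn Z (conn X Y) - conn X (conn Z Y) + conn Y (conn Z X)"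
    unfolding curvature_def conn_diff skews by simp
  ultimately show ?thesis
    by (simp add: two)
qed

theorem proposition2p6:
  fixes G :: "('p, 'b) monoid_scheme"
    and M :: "'p manifold"
    and conn :: "'p vfield \<Rightarrow> 'p vfield \<Rightarrow> 'p vfield"
  assumes "lie_group G M"
    and "compact_space (mtop M)"
    and "connected_space (mtop M)"
    and "bi_invariant_connection G M conn"
    and "\<forall>X\<in>lie_algebra G M. nomizu G M conn X X = 0"
  shows "(\<forall>X\<in>lie_algebra G M. lie_derivation G M (nomizu G M conn X)) \<longleftrightarrow>
    (\<forall>X\<in>lie_algebra G M. \<forall>Y\<in>lie_algebra G M. \<forall>Z\<in>lie_algebra G M.
       cov_torsion conn Z X Y =
       rscale 2 (curvature conn Z X Y
                 - nomizu G M conn Y (bracket Z X - nomizu G M conn Z X)))"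
proof -
  interpret lie_group G M
    by (rule assms(1))
  let ?L = "lie_algebra G M"
  note conn = assms(4)
  have nom: "nomizu G M conn X Y = conn X Y" if "X \<in> ?L" "Y \<in> ?L" for X Y
    using that by (simp add: nomizu_def)
  note closed = lie_algebra_add lie_algebra_minus lie_algebra_bracket lie_algebra_conn[OF conn]
  have aff: "conn (X + Y) Z = conn X Z + conn Y Z" "conn X (Y + Z) = conn X Y + conn X Z"
    "conn X (rscale c Y) = rscale c (conn X Y)" if "X \<in> ?L" "Y \<in> ?L" "Z \<in> ?L" for X Y Z c
    using conn that
    by (simp_all add: bi_invariant_connection_def affine_connection_def lie_algebra_vector_field)
  have alt: "conn X X = 0" if "X \<in> ?L" for X
    using assms(5) nom that by simp
  have deriv: "lie_derivation G M (nomizu G M conn Z) \<longleftrightarrow>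
      (\<forall>X\<in>?L. \<forall>Y\<in>?L. conn Z (bracket X Y) = bracket (conn Z X) Y + bracket X (conn Z Y))"
    if "Z \<in> ?L" for Z
    using that closed aff by (simp add: lie_derivation_def nom lie_algebra_rscale)
  have "cov_torsion conn Z X Y =
      rscale 2 (curvature conn Z X Y
        - nomizu G M conn Y (bracket Z X - nomizu G M conn Z X)) \<longleftrightarrow>
      conn Z (bracket X Y) = bracket (conn Z X) Y + bracket X (conn Z Y)"
    if XYZ: "X \<in> ?L" "Y \<in> ?L" "Z \<in> ?L" for X Y Z
  proof -
    have "bracket Z X - conn Z X \<in> ?L"
      using closed(1)[OF closed(3) closed(2)[OF closed(4)]] XYZ by simp
    then have "nomizu G M conn Y (bracket Z X - nomizu G M conn Z X) =
        conn Y (bracket Z X - conn Z X)"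
      using XYZ by (simp add: nom)
    moreover have "cov_torsion conn Z X Y
        - rscale 2 (curvature conn Z X Y - conn Y (bracket Z X - conn Z X)) =
      bracket (conn Z X) Y + bracket X (conn Z Y) - conn Z (bracket X Y)"
      by (rule cov_torsion_defect[where L = ?L and conn = conn])
        (fact closed aff(1,2) alt XYZ)+
    ultimately show ?thesis
      using diff_eq_diff_eq by (metis (no_types, lifting))
  qed
  with deriv show ?thesis
    by blast
qed

end
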